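(* Let $\nu_1,\nu_2>2$ and let $Q=\begin{bmatrix}1&q\\ q&1\end{bmatrix}$ be a covariance matrix (i.e. $q\in[-1,1]$). Let $X=(X_1,X_2)$ with $$X_k=\frac{G_k}{\sqrt{V_k/\nu_k}},\qquad k=1,2,$$ where $G=(G_1,G_2)\sim N(0,Q)$, $V_1,V_2$ are independent random variables, $V_k$ having the $\chi^2$ distribution with $\nu_k$ degrees of freedom, and $G$ and $(V_1,V_2)$ are independent. Let $X(1),X(2),\ldots$ be independent random vectors with the same distribution as $X$, and let $$\hat q_n:=C_{\nu_1}C_{\nu_2}\,\frac1n\sum_{t=1}^n X_1(t)X_2(t),\qquad C_\nu:=\frac{\sqrt2}{\sqrt\nu}\,\frac{\Gamma(\nu/2)}{\Gamma(\nu/2-1/2)} .$$ Then, as $n\to\infty$, $$\sqrt n\,(\hat q_n-q)\ \Rightarrow\ N\big(0,v_{\nu_1,\nu_2}(q)\big),$$ where $\Rightarrow$ denotes convergence in law and $$v_{\nu_1,\nu_2}(q)=\frac{\nu_1C_{\nu_1}^2}{\nu_1-2}\,\frac{\nu_2C_{\nu_2}^2}{\nu_2-2}\,(2q^2+1)-q^2 .$$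
   Context: $\Gamma$ is the Euler Gamma function. The $\chi^2$ distribution with (real) parameter $\nu>0$ is the law on $]0,\infty[$ with density $x\mapsto \frac{1}{2^{\nu/2}\Gamma(\nu/2)}x^{\nu/2-1}e^{-x/2}$. $N(m,v)$ denotes the Gaussian law with mean $m$ and (co)variance $v$. *)

theory Defs
  imports "HOL-Probability.Probability"
begin

(* The degenerate case v = 0 is the Dirac mass at m; normal_density takes the
   standard deviation, not the variance. Only v >= 0 is meaningful. *)
definition gaussian :: "real \<Rightarrow> real \<Rightarrow> real measure" where
  "gaussian m v =
     (if v = 0 then return borel m else density lborel (normal_density m (sqrt v)))"

(* X is a Gaussian vector with mean m and covariance matrix Q if every linear form
   of X is Gaussian with the corresponding mean and variance. Singular Q is allowed. *)
definition gaussian_vector ::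
  "'a measure \<Rightarrow> ('a \<Rightarrow> real ^ 'n) \<Rightarrow> real ^ 'n \<Rightarrow> real ^ 'n ^ 'n \<Rightarrow> bool" where
  "gaussian_vector M X m Q \<longleftrightarrow>
     X \<in> borel_measurable M \<and>
     (\<forall>u. distr M borel (\<lambda>\<omega>. u \<bullet> X \<omega>) = gaussian (u \<bullet> m) (u \<bullet> (Q *v u)))"

definition correlation_matrix :: "real \<Rightarrow> real ^ 2 ^ 2" where
  "correlation_matrix q = vector [vector [1, q], vector [q, 1]]"

definition chi_square_density :: "real \<Rightarrow> real \<Rightarrow> real" where
  "chi_square_density \<nu> x =
     (if x > 0 then 1 / (2 powr (\<nu> / 2) * Gamma (\<nu> / 2)) * x powr (\<nu> / 2 - 1) * exp (- x / 2)
      else 0)"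

definition C_coeff :: "real \<Rightarrow> real" where
  "C_coeff \<nu> = sqrt 2 / sqrt \<nu> * (Gamma (\<nu> / 2) / Gamma (\<nu> / 2 - 1 / 2))"

definition student_vector ::
  "real \<Rightarrow> real \<Rightarrow> ('a \<Rightarrow> real ^ 2) \<Rightarrow> ('a \<Rightarrow> real) \<Rightarrow> ('a \<Rightarrow> real) \<Rightarrow> 'a \<Rightarrow> real ^ 2" where
  "student_vector \<nu>\<^sub>1 \<nu>\<^sub>2 G V\<^sub>1 V\<^sub>2 \<omega> =
     vector [G \<omega> $ 1 / sqrt (V\<^sub>1 \<omega> / \<nu>\<^sub>1), G \<omega> $ 2 / sqrt (V\<^sub>2 \<omega> / \<nu>\<^sub>2)]"

definition q_hat :: "real \<Rightarrow> real \<Rightarrow> (nat \<Rightarrow> 'a \<Rightarrow> real ^ 2) \<Rightarrow> nat \<Rightarrow> 'a \<Rightarrow> real" where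
  "q_hat \<nu>\<^sub>1 \<nu>\<^sub>2 X n \<omega> = C_coeff \<nu>\<^sub>1 * C_coeff \<nu>\<^sub>2 * (1 / real n) * (\<Sum>t=1..n. X t \<omega> $ 1 * X t \<omega> $ 2)"

definition asymptotic_variance :: "real \<Rightarrow> real \<Rightarrow> real \<Rightarrow> real" where
  "asymptotic_variance \<nu>\<^sub>1 \<nu>\<^sub>2 q =
     (\<nu>\<^sub>1 * (C_coeff \<nu>\<^sub>1)\<^sup>2 / (\<nu>\<^sub>1 - 2)) * (\<nu>\<^sub>2 * (C_coeff \<nu>\<^sub>2)\<^sup>2 / (\<nu>\<^sub>2 - 2)) * (2 * q\<^sup>2 + 1) - q\<^sup>2"

end

theory Submission
  imports Defs
begin

text \<open>The estimator is an average of i.i.d. copies of \<open>C\<^sub>1 C\<^sub>2 X\<^sub>1 X\<^sub>2\<close>, so the central limit theorem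
  applies once two moments are known. By independence they factor into mixed moments of \<open>G\<close> and
  the first two moments of \<open>1 / sqrt (V\<^sub>k / \<nu>\<^sub>k)\<close>; multiplying a chi-square density by a negative
  power only changes its parameter, which gives \<open>1 / C\<^sub>k\<close> and \<open>\<nu>\<^sub>k / (\<nu>\<^sub>k - 2)\<close>. The limit is
  never degenerate: since \<open>\<nu>\<^sub>k C\<^sub>k\<^sup>2 / (\<nu>\<^sub>k - 2) \<ge> 1\<close>, the asymptotic variance is at least \<open>q\<^sup>2 + 1\<close>.\<close>

section \<open>General tools on measurability, independence, weak convergence and scaling\<close>

lemma borel_measurable_vector_2 [measurable (raw)]:
  fixes f g :: "'a \<Rightarrow> real"
  assumes [measurable]: "f \<in> borel_measurable M" "g \<in> borel_measurable M"
  shows "(\<lambda>x. vector [f x, g x] :: real ^ 2) \<in> borel_measurable M"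
proof -
  have "(vector [a, b] :: real ^ 2) = a *\<^sub>R axis 1 1 + b *\<^sub>R axis 2 1" for a b
    by (simp add: vec_eq_iff forall_2 axis_def)
  then show ?thesis by simp
qed

lemma (in prob_space) indep_vars_reindex:
  assumes "inj_on f I" and X: "indep_vars N X (f ` I)"
  shows "indep_vars (\<lambda>i. N (f i)) (\<lambda>i. X (f i)) I"
  unfolding indep_vars_def2
proof
  show "\<forall>i\<in>I. random_variable (N (f i)) (X (f i))"
    using X by (auto simp: indep_vars_def2)
  let ?F = "\<lambda>i. {X i -` A \<inter> space M |A. A \<in> sets (N i)}"
  have F: "indep_sets ?F (f ` I)"
    using X by (simp add: indep_vars_def2)
  show "indep_sets (\<lambda>i. ?F (f i)) I"
  proof (rule indep_setsI)
    show "?F (f i) \<subseteq> events" if "i \<in> I" for i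
      using F that by (auto simp only: indep_sets_def)
  next
    fix A J assume J: "J \<noteq> {}" "J \<subseteq> I" "finite J" and A: "\<forall>j\<in>J. A j \<in> ?F (f j)"
    have inj: "inj_on f J"
      using \<open>inj_on f I\<close> \<open>J \<subseteq> I\<close> by (rule inj_on_subset)
    let ?g = "the_inv_into J f"
    have g: "?g (f j) = j" if "j \<in> J" for j
      using inj that by (rule the_inv_into_f_f)
    have "prob (\<Inter>k\<in>f ` J. A (?g k)) = (\<Prod>k\<in>f ` J. prob (A (?g k)))"
    proof (rule indep_setsD[OF F])
      show "\<forall>k\<in>f ` J. A (?g k) \<in> ?F k"
        using A g by auto
    qed (use J in auto)
    then show "prob (\<Inter>j\<in>J. A j) = (\<Prod>j\<in>J. prob (A j))"
      using g by (simp add: prod.reindex[OF inj])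
  qed
qed

text \<open>As \<open>c > 0\<close>, scaling replaces each cdf by its composition with division by
  \<open>c\<close>. A continuity point x of the scaled limit cdf corresponds to the continuity point
  x / c of the original one, where convergence is assumed.\<close>

lemma weak_conv_m_scale:
  fixes c :: real
  assumes "c > 0" and \<mu>: "\<And>n. sets (\<mu> n) = sets borel" "sets \<mu>' = sets borel"
    and conv: "weak_conv_m \<mu> \<mu>'"
  shows "weak_conv_m (\<lambda>n. distr (\<mu> n) borel ((*) c)) (distr \<mu>' borel ((*) c))"
proof -
  have cdf: "cdf (distr N borel ((*) c)) = (\<lambda>x. cdf N (x / c))"
    if N: "sets N = sets borel" for N :: "real measure"
  proof
    fix x
    have "(*) c \<in> borel_measurable N"
      using N by (simp cong: measurable_cong_sets)
    moreover have "(*) c -` {..x} \<inter> space N = {..x / c}"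
      using \<open>c > 0\<close> sets_eq_imp_space_eq[OF N] by (auto simp: field_simps)
    ultimately show "cdf (distr N borel ((*) c)) x = cdf N (x / c)"
      by (simp add: cdf_def measure_distr)
  qed
  have "(\<lambda>n. cdf (\<mu> n) (x / c)) \<longlonglongrightarrow> cdf \<mu>' (x / c)"
    if "isCont (\<lambda>x. cdf \<mu>' (x / c)) x" for x
  proof -
    have "isCont (\<lambda>y. c * y) (x / c)" by simp
    then have "isCont (\<lambda>y. cdf \<mu>' (c * y / c)) (x / c)"
      by (rule isCont_o2) (use that \<open>c > 0\<close> in simp)
    then have "isCont (cdf \<mu>') (x / c)"
      using \<open>c > 0\<close> by simp
    then show ?thesis
      using conv by (auto simp: weak_conv_m_def weak_conv_def)
  qed
  then show ?thesis
    by (simp add: weak_conv_m_def weak_conv_def cdf \<mu>)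
qed

lemma distr_scale_std_normal:
  assumes "v > 0"
  shows "distr std_normal_distribution borel ((*) (sqrt v)) = gaussian 0 v"
proof -
  interpret prob_space std_normal_distribution
    by (rule prob_space_normal_density) simp
  have "distributed std_normal_distribution lborel (\<lambda>x. x) std_normal_density"
    by (simp add: distributed_def distr_id2)
  from normal_density_affine[OF this, of "sqrt v" 0]
  have "distributed std_normal_distribution lborel ((*) (sqrt v)) (normal_density 0 (sqrt v))"
    using assms by simp
  then show ?thesis
    using assms by (simp add: distributed_def gaussian_def cong: distr_cong)
qed

section \<open>Negative moments of the chi-square distribution\<close>

lemma chi_square_density_nonneg: "\<nu> > 0 \<Longrightarrow> chi_square_density \<nu> x \<ge> 0"
  by (simp add: chi_square_density_def Gamma_real_pos less_imp_le)

lemma borel_measurable_chi_square_density [measurable]: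
  "chi_square_density \<nu> \<in> borel_measurable borel"
  unfolding chi_square_density_def[abs_def] by measurable

text \<open>The substitution x = 2t turns the integral into the Euler integral for
  \<open>Gamma (\<nu> / 2)\<close>.\<close>

lemma has_bochner_integral_chi_square_density:
  assumes "\<nu> > 0"
  shows "has_bochner_integral lborel (chi_square_density \<nu>) 1"
proof (rule has_bochner_integral_nn_integral)
  let ?g = "\<lambda>t. indicator {0..} t * t powr (\<nu> / 2 - 1) / exp t :: real"
  let ?c = "Gamma (\<nu> / 2)"
  have c: "?c > 0"
    using assms by (simp add: Gamma_real_pos)
  \<comment> \<open>The unsimplified argument \<open>0 + 2 * t\<close> is what the affine
    substitution rule produces below.\<close>
  have eq: "chi_square_density \<nu> (0 + 2 * t) = ?g t / (2 * ?c)" for t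
  proof (cases "t > 0")
    case True
    have "2 powr (\<nu> / 2) = 2 * 2 powr (\<nu> / 2 - 1)"
      by (simp add: powr_diff)
    then show ?thesis
      using True c by (simp add: chi_square_density_def powr_mult exp_minus field_simps)
  qed (auto simp: chi_square_density_def indicator_def)
  have mult2: "2 * (ennreal a * ennreal b) = ennreal (2 * (a * b))" if "a \<ge> 0" "b \<ge> 0" for a b
    using that by (simp add: ennreal_mult)
  have "(\<integral>\<^sup>+x. chi_square_density \<nu> x \<partial>lborel) = 2 * (\<integral>\<^sup>+t. ?g t / (2 * ?c) \<partial>lborel)"
    by (subst nn_integral_real_affine[where c = 2 and t = 0]) (simp_all only: eq, simp_all)
  also have "(\<integral>\<^sup>+t. ?g t / (2 * ?c) \<partial>lborel) = (\<integral>\<^sup>+t. ennreal (?g t) * ennreal (1 / (2 * ?c)) \<partial>lborel)"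
    using c by (intro nn_integral_cong) (simp add: ennreal_mult'[symmetric])
  also have "\<dots> = ennreal ?c * ennreal (1 / (2 * ?c))"
    using assms by (subst nn_integral_multc) (simp_all add: Gamma_conv_nn_integral_real)
  also have "2 * \<dots> = ennreal (2 * (?c * (1 / (2 * ?c))))"
    using c mult2[of ?c "1 / (2 * ?c)"] by simp
  also have "\<dots> = ennreal 1"
    using c by simp
  finally show "(\<integral>\<^sup>+x. chi_square_density \<nu> x \<partial>lborel) = ennreal 1" .
qed (use assms in \<open>auto simp: chi_square_density_nonneg\<close>)

text \<open>The factor is the quotient of the two normalising constants. The bound
  \<open>2 * s < \<nu>\<close> keeps the new parameter positive, so
  \<open>Gamma (\<nu> / 2 - s)\<close> is nonzero and cancels.\<close>

lemma chi_square_density_times_powr: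
  assumes "2 * s < \<nu>"  "\<nu> > 0"
  shows "chi_square_density \<nu> x * x powr (- s) =
    2 powr (- s) * Gamma (\<nu> / 2 - s) / Gamma (\<nu> / 2) * chi_square_density (\<nu> - 2 * s) x"
proof (cases "x > 0")
  case True
  have *: "(\<nu> - 2 * s) / 2 = \<nu> / 2 - s" "\<nu> / 2 - 1 - s = \<nu> / 2 - s - 1"
    by (simp_all add: diff_divide_distrib)
  have "1 / (k * g) * a * e * b = d * h / g * (1 / (k * d * h) * (a * b) * e)"
    if "d > 0" "h > 0" for k g a e b d h :: real
    using that by (simp add: mult_ac)
  from this[of "2 powr (- s)" "Gamma (\<nu> / 2 - s)" "2 powr (\<nu> / 2)" "Gamma (\<nu> / 2)"
      "x powr (\<nu> / 2 - 1)" "exp (- x / 2)" "x powr (- s)"]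
  show ?thesis
    using True assms
    by (simp add: chi_square_density_def * Gamma_real_pos powr_add[symmetric])
qed (simp add: chi_square_density_def)

lemma has_bochner_integral_chi_square_powr:
  assumes "2 * s < \<nu>" "\<nu> > 0"
  shows "has_bochner_integral lborel (\<lambda>x. chi_square_density \<nu> x * x powr (- s))
    (2 powr (- s) * Gamma (\<nu> / 2 - s) / Gamma (\<nu> / 2))"
proof -
  let ?c = "2 powr (- s) * Gamma (\<nu> / 2 - s) / Gamma (\<nu> / 2)"
  have "has_bochner_integral lborel (\<lambda>x. ?c * chi_square_density (\<nu> - 2 * s) x) (?c * 1)"
    using assms by (intro has_bochner_integral_mult_right has_bochner_integral_chi_square_density) simp
  then show ?thesis
    unfolding chi_square_density_times_powr[OF assms] by simp
qed

lemma has_bochner_integral_distributed: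
  fixes g :: "'b \<Rightarrow> real"
  assumes "distributed M N X (\<lambda>x. ennreal (f x))" "g \<in> borel_measurable N" "\<And>x. 0 \<le> f x"
    and "has_bochner_integral N (\<lambda>x. f x * g x) c"
  shows "has_bochner_integral M (\<lambda>x. g (X x)) c"
  using assms distributed_integral[OF assms(1,2)] distributed_integrable[OF assms(1,2)]
  by (simp add: has_bochner_integral_iff)

text \<open>These are the negative moments with s = 1/2 and s = 1, times \<open>sqrt \<nu>\<close>
  and \<open>\<nu>\<close>; the second one is finite because \<open>\<nu> > 2\<close>.\<close>

lemma chi_square_inverse_sqrt_moments:
  assumes "\<nu> > 2" and V: "distributed M lborel V (chi_square_density \<nu>)"
  shows "has_bochner_integral M (\<lambda>\<omega>. 1 / sqrt (V \<omega> / \<nu>)) (1 / C_coeff \<nu>)"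
    and "has_bochner_integral M (\<lambda>\<omega>. (1 / sqrt (V \<omega> / \<nu>))\<^sup>2) (\<nu> / (\<nu> - 2))"
proof -
  have pos: "chi_square_density \<nu> x \<ge> 0" for x
    using assms by (simp add: chi_square_density_nonneg)
  \<comment> \<open>For x \<le> 0 the density vanishes, so the values of the root and of the power
    there do not matter.\<close>
  have 1: "chi_square_density \<nu> x * (1 / sqrt (x / \<nu>)) =
      sqrt \<nu> * (chi_square_density \<nu> x * x powr (- (1 / 2)))" for x
    using assms(1)
    by (cases "x > 0") (auto simp: chi_square_density_def powr_minus powr_half_sqrt real_sqrt_divide field_simps)
  have "2 powr (- (1 / 2)) = 1 / sqrt (2::real)"
    by (simp add: powr_minus powr_half_sqrt field_simps)
  then have "sqrt \<nu> * (2 powr (- (1 / 2)) * Gamma (\<nu> / 2 - 1 / 2) / Gamma (\<nu> / 2)) = 1 / C_coeff \<nu>"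
    by (simp add: C_coeff_def)
  moreover have "has_bochner_integral lborel
      (\<lambda>x. sqrt \<nu> * (chi_square_density \<nu> x * x powr (- (1 / 2))))
      (sqrt \<nu> * (2 powr (- (1 / 2)) * Gamma (\<nu> / 2 - 1 / 2) / Gamma (\<nu> / 2)))"
    using assms(1) by (intro has_bochner_integral_mult_right has_bochner_integral_chi_square_powr) auto
  ultimately have "has_bochner_integral lborel
      (\<lambda>x. chi_square_density \<nu> x * (1 / sqrt (x / \<nu>))) (1 / C_coeff \<nu>)"
    unfolding 1 by simp
  then show "has_bochner_integral M (\<lambda>\<omega>. 1 / sqrt (V \<omega> / \<nu>)) (1 / C_coeff \<nu>)"
    by (rule has_bochner_integral_distributed[OF V, rotated 2]) (use pos in auto)
  have 2: "chi_square_density \<nu> x * (1 / sqrt (x / \<nu>))\<^sup>2 =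
      \<nu> * (chi_square_density \<nu> x * x powr (- 1))" for x
    using assms(1)
    by (cases "x > 0") (auto simp: chi_square_density_def powr_minus power_divide field_simps)
  \<comment> \<open>The functional equation of Gamma cancels the quotient of Gamma values and leaves
    a rational function of \<open>\<nu>\<close>.\<close>
  have "Gamma (\<nu> / 2) = (\<nu> / 2 - 1) * Gamma (\<nu> / 2 - 1)"
    using assms(1) Gamma_plus1[of "\<nu> / 2 - 1"] nonpos_Ints_nonpos[of "\<nu> / 2 - 1"] by fastforce
  moreover have "Gamma (\<nu> / 2 - 1) > 0"
    using assms(1) by (simp add: Gamma_real_pos)
  moreover have "\<nu> * (1 / 2 * g / ((\<nu> / 2 - 1) * g)) = \<nu> / (\<nu> - 2)" if "g > 0" for g
    using that assms(1) by (simp add: divide_simps)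
  ultimately have c2: "\<nu> * (2 powr (- 1) * Gamma (\<nu> / 2 - 1) / Gamma (\<nu> / 2)) = \<nu> / (\<nu> - 2)"
    by (simp add: powr_minus)
  have "has_bochner_integral lborel
      (\<lambda>x. \<nu> * (chi_square_density \<nu> x * x powr (- 1)))
      (\<nu> * (2 powr (- 1) * Gamma (\<nu> / 2 - 1) / Gamma (\<nu> / 2)))"
    using assms(1) by (intro has_bochner_integral_mult_right has_bochner_integral_chi_square_powr) auto
  then have "has_bochner_integral lborel
      (\<lambda>x. chi_square_density \<nu> x * (1 / sqrt (x / \<nu>))\<^sup>2) (\<nu> / (\<nu> - 2))"
    unfolding 2 c2 .
  then show "has_bochner_integral M (\<lambda>\<omega>. (1 / sqrt (V \<omega> / \<nu>))\<^sup>2) (\<nu> / (\<nu> - 2))"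
    by (rule has_bochner_integral_distributed[OF V, rotated 2]) (use pos in auto)
qed

lemma C_coeff_pos: "\<nu> > 1 \<Longrightarrow> C_coeff \<nu> > 0"
  by (simp add: C_coeff_def Gamma_real_pos)

text \<open>Jensen's inequality for the first two moments of \<open>1 / sqrt (V / \<nu>)\<close>.\<close>

lemma (in prob_space) C_coeff_square_ge:
  assumes "\<nu> > 2" and V: "distributed M lborel V (chi_square_density \<nu>)"
  shows "\<nu> * (C_coeff \<nu>)\<^sup>2 / (\<nu> - 2) \<ge> 1"
proof -
  note m = chi_square_inverse_sqrt_moments[OF assms, unfolded has_bochner_integral_iff]
  have "0 \<le> variance (\<lambda>\<omega>. 1 / sqrt (V \<omega> / \<nu>))"
    by (rule variance_positive)
  also have "\<dots> = \<nu> / (\<nu> - 2) - (1 / C_coeff \<nu>)\<^sup>2"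
    using m by (subst variance_eq) simp_all
  finally show ?thesis
    using assms(1) C_coeff_pos[of \<nu>] by (simp add: field_simps power_divide)
qed

section \<open>Gaussian moments of order two and four, and mixed moments of the pair\<close>

text \<open>The case \<open>v = 0\<close> does arise: for q = 1 or q = -1 one of the forms G1 - G2
  and G1 + G2 has variance zero. Its law is then the Dirac mass at 0, where both powers
  vanish.\<close>

lemma gaussian_moments:
  assumes "v \<ge> 0"
  shows "has_bochner_integral (gaussian 0 v) (\<lambda>x. x\<^sup>2) v"
    and "has_bochner_integral (gaussian 0 v) (\<lambda>x. x ^ 4) (3 * v\<^sup>2)"
proof -
  have "has_bochner_integral (gaussian 0 v) (\<lambda>x. x\<^sup>2) v \<and>
      has_bochner_integral (gaussian 0 v) (\<lambda>x. x ^ 4) (3 * v\<^sup>2)"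
  proof (cases "v = 0")
    case True
    interpret prob_space "return borel (0 :: real)"
      by (rule prob_space_return) simp
    have "integrable (return borel (0::real)) (\<lambda>x. x ^ n)" if "n > 0" for n
      using that by (intro integrable_const_bound[where B = 0]) (auto simp: AE_return)
    then show ?thesis
      using True by (simp add: gaussian_def has_bochner_integral_iff integral_return)
  next
    case False
    then have v: "v > 0" "sqrt v > 0"
      using assms by simp_all
    have "has_bochner_integral lborel (\<lambda>x. normal_density 0 (sqrt v) x * x\<^sup>2) v"
      using normal_moment_even[OF v(2), of 0 1] v(1) by simp
    moreover have "has_bochner_integral lborel (\<lambda>x. normal_density 0 (sqrt v) x * x ^ 4) (3 * v\<^sup>2)"
      using normal_moment_even[OF v(2), of 0 2] v(1) by (simp add: fact_numeral power_divide)
    ultimately show ?thesis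
      using v(1) by (auto simp: gaussian_def intro!: has_bochner_integral_density)
  qed
  then show "has_bochner_integral (gaussian 0 v) (\<lambda>x. x\<^sup>2) v"
    and "has_bochner_integral (gaussian 0 v) (\<lambda>x. x ^ 4) (3 * v\<^sup>2)" by auto
qed

lemma gaussian_vector_linear_moments:
  assumes G: "gaussian_vector M G 0 Q" and "u \<bullet> (Q *v u) \<ge> 0"
  shows "has_bochner_integral M (\<lambda>\<omega>. (u \<bullet> G \<omega>)\<^sup>2) (u \<bullet> (Q *v u))"
    and "has_bochner_integral M (\<lambda>\<omega>. (u \<bullet> G \<omega>) ^ 4) (3 * (u \<bullet> (Q *v u))\<^sup>2)"
proof -
  have [measurable]: "G \<in> borel_measurable M"
    and d: "distr M borel (\<lambda>\<omega>. u \<bullet> G \<omega>) = gaussian 0 (u \<bullet> (Q *v u))"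
    using G by (simp_all add: gaussian_vector_def)
  from gaussian_moments[OF assms(2)]
  show "has_bochner_integral M (\<lambda>\<omega>. (u \<bullet> G \<omega>)\<^sup>2) (u \<bullet> (Q *v u))"
    and "has_bochner_integral M (\<lambda>\<omega>. (u \<bullet> G \<omega>) ^ 4) (3 * (u \<bullet> (Q *v u))\<^sup>2)"
    unfolding d[symmetric]
    by (auto simp: has_bochner_integral_iff integrable_distr_eq integral_distr)
qed

text \<open>Both mixed moments come from the linear forms \<open>G\<^sub>1 \<plusminus> G\<^sub>2\<close>, \<open>G\<^sub>1\<close>, \<open>G\<^sub>2\<close> by polarization.\<close>

lemma gaussian_vector_product_moments:
  assumes G: "gaussian_vector M G 0 (correlation_matrix q)" and q: "q \<in> {-1..1}"
  shows "has_bochner_integral M (\<lambda>\<omega>. G \<omega> $ 1 * G \<omega> $ 2) q"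
    and "has_bochner_integral M (\<lambda>\<omega>. (G \<omega> $ 1 * G \<omega> $ 2)\<^sup>2) (2 * q\<^sup>2 + 1)"
proof -
  let ?u = "\<lambda>a b. vector [a, b] :: real ^ 2"
  have form: "?u a b \<bullet> (correlation_matrix q *v ?u a b) = a\<^sup>2 + 2 * q * a * b + b\<^sup>2" for a b
    by (simp add: inner_vec_def sum_2 correlation_matrix_def matrix_vector_mult_def
        power2_eq_square algebra_simps)
  have lin: "?u a b \<bullet> G \<omega> = a * G \<omega> $ 1 + b * G \<omega> $ 2" for a b \<omega>
    by (simp add: inner_vec_def sum_2)
  note m = gaussian_vector_linear_moments[OF G, of "?u _ _", unfolded form lin]
  \<comment> \<open>G1 + G2 and G1 - G2 have variances 2 + 2q and 2 - 2q, which are nonnegative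
    because q lies in [-1, 1].\<close>
  have m2: "has_bochner_integral M (\<lambda>\<omega>. ((G \<omega> $ 1 + G \<omega> $ 2)\<^sup>2 - (G \<omega> $ 1 - G \<omega> $ 2)\<^sup>2) / 4)
      (((2 + 2 * q) - (2 - 2 * q)) / 4)"
    using m(1)[of 1 1] m(1)[of 1 "-1"] q
    by (intro has_bochner_integral_divide_zero has_bochner_integral_diff) auto
  have "((a + b)\<^sup>2 - (a - b)\<^sup>2) / 4 = a * b" for a b :: real
    by (simp add: power2_eq_square algebra_simps)
  with m2 show "has_bochner_integral M (\<lambda>\<omega>. G \<omega> $ 1 * G \<omega> $ 2) q"
    by simp
  \<comment> \<open>In (a + b)^4 + (a - b)^4 the odd terms cancel and 2a^4 + 12a^2b^2 + 2b^4
    remains. Each form contributes three times its squared variance, and G1, G2 have variance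
    1.\<close>
  have m4: "has_bochner_integral M
      (\<lambda>\<omega>. ((G \<omega> $ 1 + G \<omega> $ 2) ^ 4 + (G \<omega> $ 1 - G \<omega> $ 2) ^ 4
        - 2 * (G \<omega> $ 1) ^ 4 - 2 * (G \<omega> $ 2) ^ 4) / 12)
      ((3 * (2 + 2 * q)\<^sup>2 + 3 * (2 - 2 * q)\<^sup>2 - 2 * 3 - 2 * 3) / 12)"
    using m(2)[of 1 1] m(2)[of 1 "-1"] m(2)[of 1 0] m(2)[of 0 1] q
    by (intro has_bochner_integral_divide_zero has_bochner_integral_diff
        has_bochner_integral_add has_bochner_integral_mult_right) auto
  have "((a + b) ^ 4 + (a - b) ^ 4 - 2 * a ^ 4 - 2 * b ^ 4) / 12 = (a * b)\<^sup>2" for a b :: real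
    by (simp add: eval_nat_numeral algebra_simps)
  with m4 have "has_bochner_integral M (\<lambda>\<omega>. (G \<omega> $ 1 * G \<omega> $ 2)\<^sup>2)
      ((3 * (2 + 2 * q)\<^sup>2 + 3 * (2 - 2 * q)\<^sup>2 - 2 * 3 - 2 * 3) / 12)"
    by (simp only:)
  moreover have "(3 * (2 + 2 * q)\<^sup>2 + 3 * (2 - 2 * q)\<^sup>2 - 2 * 3 - 2 * 3) / 12 = 2 * q\<^sup>2 + 1"
    by (simp add: power2_eq_square algebra_simps)
  ultimately show "has_bochner_integral M (\<lambda>\<omega>. (G \<omega> $ 1 * G \<omega> $ 2)\<^sup>2) (2 * q\<^sup>2 + 1)"
    by (simp only:)
qed

section \<open>Moments of the product of the two Student coordinates\<close>

lemma (in prob_space) has_bochner_integral_indep_mult: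
  fixes X Y :: "'a \<Rightarrow> real"
  assumes "indep_var borel X borel Y"
    and "has_bochner_integral M X a" "has_bochner_integral M Y b"
  shows "has_bochner_integral M (\<lambda>\<omega>. X \<omega> * Y \<omega>) (a * b)"
  using assms indep_var_integrable[OF assms(1)] indep_var_lebesgue_integral[OF assms(1)]
  by (simp add: has_bochner_integral_iff)

text \<open>Expectations factor in two stages: G is independent of the pair (V1, V2), hence of any
  function of it, and V1 is independent of V2.\<close>

lemma (in prob_space) has_bochner_integral_indep_mult3:
  fixes f :: "real ^ 2 \<Rightarrow> real" and g h :: "real \<Rightarrow> real" and G :: "'a \<Rightarrow> real ^ 2"
  assumes V: "indep_var borel V\<^sub>1 borel V\<^sub>2"
    and G: "indep_var borel G borel (\<lambda>\<omega>. vector [V\<^sub>1 \<omega>, V\<^sub>2 \<omega>] :: real ^ 2)"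
    and [measurable]: "f \<in> borel_measurable borel" "g \<in> borel_measurable borel" "h \<in> borel_measurable borel"
    and "has_bochner_integral M (\<lambda>\<omega>. f (G \<omega>)) a"
      "has_bochner_integral M (\<lambda>\<omega>. g (V\<^sub>1 \<omega>)) b" "has_bochner_integral M (\<lambda>\<omega>. h (V\<^sub>2 \<omega>)) c"
  shows "has_bochner_integral M (\<lambda>\<omega>. f (G \<omega>) * (g (V\<^sub>1 \<omega>) * h (V\<^sub>2 \<omega>))) (a * (b * c))"
proof (intro has_bochner_integral_indep_mult)
  show "indep_var borel (\<lambda>\<omega>. g (V\<^sub>1 \<omega>)) borel (\<lambda>\<omega>. h (V\<^sub>2 \<omega>))"
    using indep_var_compose[OF V, of g borel h borel] by (simp add: comp_def)
  show "indep_var borel (\<lambda>\<omega>. f (G \<omega>)) borel (\<lambda>\<omega>. g (V\<^sub>1 \<omega>) * h (V\<^sub>2 \<omega>))"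
    using indep_var_compose[OF G, of f borel "\<lambda>v. g (v $ 1) * h (v $ 2)" borel]
    by (simp add: comp_def)
qed fact+

lemma (in prob_space) student_product_moments:
  assumes "\<nu>\<^sub>1 > 2" "\<nu>\<^sub>2 > 2" "q \<in> {-1..1}"
    and G: "gaussian_vector M G 0 (correlation_matrix q)"
    and V: "distributed M lborel V\<^sub>1 (chi_square_density \<nu>\<^sub>1)"
      "distributed M lborel V\<^sub>2 (chi_square_density \<nu>\<^sub>2)"
    and indep: "indep_var borel V\<^sub>1 borel V\<^sub>2"
      "indep_var borel G borel (\<lambda>\<omega>. vector [V\<^sub>1 \<omega>, V\<^sub>2 \<omega>] :: real ^ 2)"
  defines "X \<equiv> student_vector \<nu>\<^sub>1 \<nu>\<^sub>2 G V\<^sub>1 V\<^sub>2"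
  shows "has_bochner_integral M (\<lambda>\<omega>. X \<omega> $ 1 * X \<omega> $ 2) (q / (C_coeff \<nu>\<^sub>1 * C_coeff \<nu>\<^sub>2))"
    and "has_bochner_integral M (\<lambda>\<omega>. (X \<omega> $ 1 * X \<omega> $ 2)\<^sup>2)
      ((2 * q\<^sup>2 + 1) * (\<nu>\<^sub>1 / (\<nu>\<^sub>1 - 2) * (\<nu>\<^sub>2 / (\<nu>\<^sub>2 - 2))))"
proof -
  note chi = chi_square_inverse_sqrt_moments[OF assms(1) V(1)] chi_square_inverse_sqrt_moments[OF assms(2) V(2)]
  note gauss = gaussian_vector_product_moments[OF G assms(3)]
  have [measurable]: "(\<lambda>x::real^2. x $ i) \<in> borel_measurable borel" for i
    by (rule borel_measurable_nth)
  have X: "X \<omega> $ 1 * X \<omega> $ 2 = G \<omega> $ 1 * G \<omega> $ 2 * (1 / sqrt (V\<^sub>1 \<omega> / \<nu>\<^sub>1) * (1 / sqrt (V\<^sub>2 \<omega> / \<nu>\<^sub>2)))" for \<omega>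
    by (simp add: X_def student_vector_def)
  have "has_bochner_integral M (\<lambda>\<omega>. X \<omega> $ 1 * X \<omega> $ 2) (q * (1 / C_coeff \<nu>\<^sub>1 * (1 / C_coeff \<nu>\<^sub>2)))"
    unfolding X
    by (rule has_bochner_integral_indep_mult3[OF indep, where f = "\<lambda>x. x $ 1 * x $ 2"
          and g = "\<lambda>x. 1 / sqrt (x / \<nu>\<^sub>1)" and h = "\<lambda>x. 1 / sqrt (x / \<nu>\<^sub>2)"])
      (use chi gauss in simp_all)
  then show "has_bochner_integral M (\<lambda>\<omega>. X \<omega> $ 1 * X \<omega> $ 2) (q / (C_coeff \<nu>\<^sub>1 * C_coeff \<nu>\<^sub>2))"
    by simp
  show "has_bochner_integral M (\<lambda>\<omega>. (X \<omega> $ 1 * X \<omega> $ 2)\<^sup>2)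
      ((2 * q\<^sup>2 + 1) * (\<nu>\<^sub>1 / (\<nu>\<^sub>1 - 2) * (\<nu>\<^sub>2 / (\<nu>\<^sub>2 - 2))))"
    \<comment> \<open>The square is distributed only over the three independent factors, so the
      square of G1 G2 stays one function of G.\<close>
    unfolding X power_mult_distrib[of "G _ $ 1 * G _ $ 2"] power_mult_distrib[of "1 / sqrt _"]
    by (rule has_bochner_integral_indep_mult3[OF indep, where f = "\<lambda>x. (x $ 1 * x $ 2)\<^sup>2"
          and g = "\<lambda>x. (1 / sqrt (x / \<nu>\<^sub>1))\<^sup>2" and h = "\<lambda>x. (1 / sqrt (x / \<nu>\<^sub>2))\<^sup>2"])
      (use chi gauss in simp_all)
qed

section \<open>The central limit theorem applied to the rescaled products\<close>

theorem proposition5: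
  fixes \<nu>\<^sub>1 \<nu>\<^sub>2 q :: real
    and M :: "'a measure" and G :: "'a \<Rightarrow> real ^ 2" and V\<^sub>1 V\<^sub>2 :: "'a \<Rightarrow> real"
    and M' :: "'b measure" and X :: "nat \<Rightarrow> 'b \<Rightarrow> real ^ 2"
  assumes "\<nu>\<^sub>1 > 2" and "\<nu>\<^sub>2 > 2" and "q \<in> {-1..1}"
    and "prob_space M"
    and "gaussian_vector M G 0 (correlation_matrix q)"
    and "distributed M lborel V\<^sub>1 (chi_square_density \<nu>\<^sub>1)"
    and "distributed M lborel V\<^sub>2 (chi_square_density \<nu>\<^sub>2)"
    and "prob_space.indep_var M borel V\<^sub>1 borel V\<^sub>2"
    and "prob_space.indep_var M borel G borel (\<lambda>\<omega>. vector [V\<^sub>1 \<omega>, V\<^sub>2 \<omega>])"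
    and "prob_space M'"
    and "prob_space.indep_vars M' (\<lambda>_. borel) X {1..}"
    and "\<And>t. t \<ge> 1 \<Longrightarrow> distr M' borel (X t) = distr M borel (student_vector \<nu>\<^sub>1 \<nu>\<^sub>2 G V\<^sub>1 V\<^sub>2)"
  shows "weak_conv_m (\<lambda>n. distr M' borel (\<lambda>\<omega>. sqrt (real n) * (q_hat \<nu>\<^sub>1 \<nu>\<^sub>2 X n \<omega> - q)))
           (gaussian 0 (asymptotic_variance \<nu>\<^sub>1 \<nu>\<^sub>2 q))"
proof -
  interpret M: prob_space M by fact
  interpret M': prob_space M' by fact
  define c where "c = C_coeff \<nu>\<^sub>1 * C_coeff \<nu>\<^sub>2"
  define v where "v = asymptotic_variance \<nu>\<^sub>1 \<nu>\<^sub>2 q"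
  define p where "p x = c * (x $ 1 * x $ 2)" for x :: "real ^ 2"
  \<comment> \<open>With the constant \<open>c\<close> absorbed into \<open>p\<close>, the estimator
    is the plain average of the first n terms of \<open>Y\<close>, which is numbered from 0.\<close>
  define Y where "Y i \<omega> = p (X (Suc i) \<omega>)" for i \<omega>
  let ?S = "student_vector \<nu>\<^sub>1 \<nu>\<^sub>2 G V\<^sub>1 V\<^sub>2"
  have "c > 0"
    using assms(1,2) by (simp add: c_def C_coeff_pos)
  have [measurable]: "(\<lambda>x::real^2. x $ i) \<in> borel_measurable borel" for i
    by (rule borel_measurable_nth)
  then have p [measurable]: "p \<in> borel_measurable borel"
    unfolding p_def[abs_def] by measurable
  have [measurable]: "G \<in> borel_measurable M" "V\<^sub>1 \<in> borel_measurable M" "V\<^sub>2 \<in> borel_measurable M"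
    using M.indep_var_rv1[OF assms(9)] M.indep_var_rv1[OF assms(8)] M.indep_var_rv2[OF assms(8)] by auto
  have [measurable]: "?S \<in> borel_measurable M"
    unfolding student_vector_def[abs_def] by measurable
  have X [measurable]: "X (Suc i) \<in> borel_measurable M'" for i
    using assms(11) by (auto simp: M'.indep_vars_def2)

  note S = M.student_product_moments[OF assms(1-3,5-9)]
  have "has_bochner_integral M (\<lambda>\<omega>. p (?S \<omega>)) (c * (q / c))"
    unfolding p_def c_def by (rule has_bochner_integral_mult_right) (rule S)
  then have p1: "has_bochner_integral M (\<lambda>\<omega>. p (?S \<omega>)) q"
    using \<open>c > 0\<close> by simp
  have "has_bochner_integral M (\<lambda>\<omega>. (p (?S \<omega>))\<^sup>2)
      (c\<^sup>2 * ((2 * q\<^sup>2 + 1) * (\<nu>\<^sub>1 / (\<nu>\<^sub>1 - 2) * (\<nu>\<^sub>2 / (\<nu>\<^sub>2 - 2)))))"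
    unfolding p_def power_mult_distrib[of c] by (rule has_bochner_integral_mult_right) (rule S)
  \<comment> \<open>Written as \<open>v + q\<^sup>2\<close>, so that subtracting the squared mean
    leaves the variance \<open>v\<close>.\<close>
  also have "c\<^sup>2 * ((2 * q\<^sup>2 + 1) * (\<nu>\<^sub>1 / (\<nu>\<^sub>1 - 2) * (\<nu>\<^sub>2 / (\<nu>\<^sub>2 - 2)))) = v + q\<^sup>2"
    by (simp add: v_def asymptotic_variance_def c_def power_mult_distrib)
  finally have p2: "has_bochner_integral M (\<lambda>\<omega>. (p (?S \<omega>))\<^sup>2) (v + q\<^sup>2)" .

  \<comment> \<open>The moments are known on \<open>M\<close>, whereas the samples live on
    \<open>M'\<close>; the two spaces are linked only by the common law of the vectors.\<close>
  have transfer: "has_bochner_integral M' (\<lambda>\<omega>. f (Y i \<omega>)) a"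
    if "has_bochner_integral M (\<lambda>\<omega>. f (p (?S \<omega>))) a" and [measurable]: "f \<in> borel_measurable borel"
    for f :: "real \<Rightarrow> real" and a i
  proof -
    have "has_bochner_integral (distr M borel ?S) (\<lambda>x. f (p x)) a"
      using that by (simp add: has_bochner_integral_iff integrable_distr_eq integral_distr)
    then have "has_bochner_integral (distr M' borel (X (Suc i))) (\<lambda>x. f (p x)) a"
      using assms(12)[of "Suc i"] by simp
    then show ?thesis
      by (simp add: Y_def has_bochner_integral_iff integrable_distr_eq integral_distr)
  qed
  have Y1: "has_bochner_integral M' (Y i) q" for i
    using transfer[of "\<lambda>x. x"] p1 by simp
  have Y2: "has_bochner_integral M' (\<lambda>\<omega>. (Y i \<omega>)\<^sup>2) (v + q\<^sup>2)" for i
    using transfer[of "\<lambda>x. x\<^sup>2"] p2 by simp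

  \<comment> \<open>Positivity of \<open>v\<close> is needed for the normalisation in the central
    limit theorem and puts the limit in the density case of \<open>gaussian\<close>.\<close>
  have "1 * 1 \<le> (\<nu>\<^sub>1 * (C_coeff \<nu>\<^sub>1)\<^sup>2 / (\<nu>\<^sub>1 - 2)) * (\<nu>\<^sub>2 * (C_coeff \<nu>\<^sub>2)\<^sup>2 / (\<nu>\<^sub>2 - 2))"
    using M.C_coeff_square_ge[OF assms(1,6)] M.C_coeff_square_ge[OF assms(2,7)]
    by (intro mult_mono) auto
  then have "1 * (2 * q\<^sup>2 + 1) \<le> v + q\<^sup>2"
    unfolding v_def asymptotic_variance_def diff_add_cancel by (intro mult_right_mono) auto
  then have "q\<^sup>2 + 1 \<le> v" by simp
  moreover have "0 < q\<^sup>2 + 1" by (simp add: add_nonneg_pos)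
  ultimately have "v > 0" by (rule less_le_trans[rotated])

  have Y_indep: "M'.indep_vars (\<lambda>_. borel) Y UNIV"
  proof -
    have "range Suc = {1..}"
      by (auto simp: image_iff) (metis Suc_le_D)
    then have "M'.indep_vars (\<lambda>_. borel) (\<lambda>i. X (Suc i)) UNIV"
      using M'.indep_vars_reindex[of Suc UNIV "\<lambda>_. borel" X] assms(11) by simp
    then show ?thesis
      unfolding Y_def[abs_def] by (rule M'.indep_vars_compose2) (rule p)
  qed
  \<comment> \<open>The right-hand side does not depend on \<open>i\<close>: this is the identical
    distribution of the \<open>Y i\<close>.\<close>
  have Y_distr: "distr M' borel (Y i) = distr (distr M borel ?S) borel p" for i
    using assms(12)[of "Suc i", symmetric] by (simp add: distr_distr Y_def[abs_def] comp_def)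
  have "weak_conv_m (\<lambda>n. distr M' borel (\<lambda>x. (\<Sum>i<n. Y i x - q) / sqrt (real n * (sqrt v)\<^sup>2)))
      std_normal_distribution"
  proof (rule M'.central_limit_theorem[OF Y_indep])
    show "M'.variance (Y n) = (sqrt v)\<^sup>2" for n
      using Y1[of n] Y2[of n] \<open>v > 0\<close> by (subst M'.variance_eq) (simp_all add: has_bochner_integral_iff)
  qed (use Y1 Y2 \<open>v > 0\<close> Y_distr in \<open>auto simp: has_bochner_integral_iff\<close>)
  \<comment> \<open>Multiplying by \<open>sqrt v\<close> undoes the division by the standard
    deviation.\<close>
  then have "weak_conv_m
      (\<lambda>n. distr (distr M' borel (\<lambda>x. (\<Sum>i<n. Y i x - q) / sqrt (real n * (sqrt v)\<^sup>2))) borel ((*) (sqrt v)))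
      (distr std_normal_distribution borel ((*) (sqrt v)))"
    using \<open>v > 0\<close> by (intro weak_conv_m_scale) simp_all
  moreover have "distr (distr M' borel (\<lambda>x. (\<Sum>i<n. Y i x - q) / sqrt (real n * (sqrt v)\<^sup>2))) borel ((*) (sqrt v)) =
      distr M' borel (\<lambda>\<omega>. sqrt (real n) * (q_hat \<nu>\<^sub>1 \<nu>\<^sub>2 X n \<omega> - q))" for n
  proof -
    have [measurable]: "Y i \<in> borel_measurable M'" for i
      unfolding Y_def[abs_def] by measurable
    have "sqrt v * ((\<Sum>i<n. Y i \<omega> - q) / sqrt (real n * (sqrt v)\<^sup>2)) =
        sqrt (real n) * (q_hat \<nu>\<^sub>1 \<nu>\<^sub>2 X n \<omega> - q)" for \<omega>
    \<comment> \<open>For n = 0 both sides are 0 (empty sum, \<open>sqrt 0\<close>); otherwise the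
      factor 1 / n in \<open>q_hat\<close> can be cleared.\<close>
    proof (cases "n = 0")
      case False
      have "(\<Sum>t=1..n. X t \<omega> $ 1 * X t \<omega> $ 2) = (\<Sum>i<n. X (Suc i) \<omega> $ 1 * X (Suc i) \<omega> $ 2)"
        by (rule sum.reindex_bij_witness[where i = Suc and j = "\<lambda>t. t - 1"]) auto
      then have "q_hat \<nu>\<^sub>1 \<nu>\<^sub>2 X n \<omega> = (\<Sum>i<n. Y i \<omega>) / real n"
        by (simp add: q_hat_def Y_def p_def c_def sum_distrib_left sum_divide_distrib)
      then have "(\<Sum>i<n. Y i \<omega> - q) = real n * (q_hat \<nu>\<^sub>1 \<nu>\<^sub>2 X n \<omega> - q)"
        using False by (simp add: sum_subtractf algebra_simps)
      then show ?thesis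
        using \<open>v > 0\<close> False by (simp add: real_sqrt_mult field_simps)
    qed simp
    then show ?thesis
      by (simp add: distr_distr comp_def)
  qed
  ultimately show ?thesis
    using \<open>v > 0\<close> by (simp add: distr_scale_std_normal v_def)
qed

end
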